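(* Let $G_1$ be an $r_1$-regular graph on $n_1$ vertices and $G_2$ an arbitrary graph on $n_2$ vertices, where $n_1 \geq 2$, $n_2 \geq 1$ and $r_1 \geq 1$, and let $\nu_1(G_1)\le\dots\le\nu_{n_1}(G_1)$ be the eigenvalues of $Q(G_1)$. Then $$\phi(Q(G_1 \star G_2); x) = (\phi(Q(G_2); x - r_1))^{n_1} \cdot \prod_{i=1}^{n_1} \left(x - n_2 r_1 - \nu_i(G_1) - \Gamma_{Q(G_2)}(x - r_1)\,(\nu_i(G_1) - r_1)^2\right).$$
   Context: All graphs are finite, undirected and simple. For a graph $G$, $A(G)$ is its adjacency matrix, $D(G)$ the diagonal matrix of vertex degrees, and $Q(G)=D(G)+A(G)$ its signless Laplacian matrix. For a square matrix $M$ of order $n$, $\phi(M;x)=\det(xI_n-M)$, and the $M$-coronal is the rational function $\Gamma_M(x)=\mathbf{1}_n^T(xI_n-M)^{-1}\mathbf{1}_n$ with $\mathbf{1}_n$ the all-ones column vector. The neighbourhood corona $G_1\star G_2$ of graphs $G_1$ (with vertices $v_1,\dots,v_{n_1}$) and $G_2$ is the graph obtained by taking one copy of $G_1$ and $n_1$ copies of $G_2$, all vertex-disjoint, and joining every neighbour (in $G_1$) of $v_i$ to every vertex of the $i$th copy of $G_2$ by a new edge, for each $i$. The identity is one of rational functions in $x$. *)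

theory Defs
  imports
    "Graph_Theory.Pair_Digraph"
    "Jordan_Normal_Form.Char_Poly"
    "HOL-Computational_Algebra.Normalized_Fraction"
    "HOL-Computational_Algebra.Field_as_Ring"
    "HOL-Library.Multiset"
begin

text \<open>
  A finite simple undirected graph is a \<^locale>\<open>pair_graph\<close>: finitely many vertices and a
  symmetric, irreflexive set of arcs, so that an edge $uv$ is the pair of arcs \<open>(u, v)\<close>, \<open>(v, u)\<close>
  and the out-degree is the degree.

  Matrices are indexed by natural numbers, so the matrices of a graph depend on a list
  enumerating its vertices without repetition.
\<close>

definition vertex_enum :: "'a list \<Rightarrow> 'a pair_pre_digraph \<Rightarrow> bool" where
  "vertex_enum vs G \<longleftrightarrow> distinct vs \<and> set vs = pverts G"

definition regular :: "nat \<Rightarrow> 'a pair_pre_digraph \<Rightarrow> bool" where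
  "regular r G \<longleftrightarrow> (\<forall>v\<in>pverts G. out_degree (with_proj G) v = r)"

definition adjacency_matrix :: "'a list \<Rightarrow> 'a pair_pre_digraph \<Rightarrow> real mat" where
  "adjacency_matrix vs G =
     mat (length vs) (length vs) (\<lambda>(i, j). if (vs ! i, vs ! j) \<in> parcs G then 1 else 0)"

definition degree_matrix :: "'a list \<Rightarrow> 'a pair_pre_digraph \<Rightarrow> real mat" where
  "degree_matrix vs G =
     mat (length vs) (length vs)
       (\<lambda>(i, j). if i = j then real (out_degree (with_proj G) (vs ! i)) else 0)"

definition signless_laplacian :: "'a list \<Rightarrow> 'a pair_pre_digraph \<Rightarrow> real mat" where
  "signless_laplacian vs G = degree_matrix vs G + adjacency_matrix vs G"

text \<open>
  \<open>Inl u\<close> is the vertex \<open>u\<close> of the copy of \<open>G1\<close>, and \<open>Inr (v, b)\<close> is the vertex \<open>b\<close> in the copy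
  of \<open>G2\<close> that belongs to the vertex \<open>v\<close> of \<open>G1\<close>.
\<close>

definition neighbourhood_corona ::
    "'a pair_pre_digraph \<Rightarrow> 'b pair_pre_digraph \<Rightarrow> ('a + 'a \<times> 'b) pair_pre_digraph" where
  "neighbourhood_corona G1 G2 =
     \<lparr> pverts = Inl ` pverts G1 \<union> Inr ` (pverts G1 \<times> pverts G2),
       parcs =
         {(Inl u, Inl v) | u v. (u, v) \<in> parcs G1}
         \<union> {(Inr (v, a), Inr (v, b)) | v a b. v \<in> pverts G1 \<and> (a, b) \<in> parcs G2}
         \<union> {(Inl u, Inr (v, b)) | u v b. (u, v) \<in> parcs G1 \<and> b \<in> pverts G2}
         \<union> {(Inr (v, b), Inl u) | u v b. (u, v) \<in> parcs G1 \<and> b \<in> pverts G2} \<rparr>"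

lemma pair_graph_neighbourhood_corona:
  assumes "pair_graph G1" and "pair_graph G2"
  shows "pair_graph (neighbourhood_corona G1 G2)"
proof -
  interpret G1: pair_graph G1 by fact
  interpret G2: pair_graph G2 by fact
  let ?G = "neighbourhood_corona G1 G2"
  have wf: "pair_wf_digraph ?G"
    by unfold_locales
      (auto simp: neighbourhood_corona_def dest: G1.arc_fst_in_verts G1.arc_snd_in_verts
        G2.arc_fst_in_verts G2.arc_snd_in_verts)
  have fin: "finite (pverts ?G)"
    by (simp add: neighbourhood_corona_def G1.pair_finite_verts G2.pair_finite_verts)
  have "parcs ?G \<subseteq> pverts ?G \<times> pverts ?G"
    using pair_wf_digraph.arc_fst_in_verts[OF wf] pair_wf_digraph.arc_snd_in_verts[OF wf]
    by fastforce
  then have fina: "finite (parcs ?G)"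
    using fin finite_subset by blast
  have s1: "(u, v) \<in> parcs G1 \<Longrightarrow> (v, u) \<in> parcs G1" for u v
    using G1.pair_sym_arcs by (simp add: symmetric_def sym_def)
  have s2: "(u, v) \<in> parcs G2 \<Longrightarrow> (v, u) \<in> parcs G2" for u v
    using G2.pair_sym_arcs by (simp add: symmetric_def sym_def)
  have sym: "symmetric (with_proj ?G)"
    unfolding symmetric_def by (auto simp: neighbourhood_corona_def intro!: symI dest: s1 s2)
  have "fst e \<noteq> snd e" if "e \<in> parcs ?G" for e
    using that by (auto simp: neighbourhood_corona_def dest: G1.pair_no_loops G2.pair_no_loops)
  with wf fin fina sym show ?thesis
    by (simp add: pair_graph_def pair_digraph_def pair_fin_digraph_def pair_fin_digraph_axioms_def
        pair_loopfree_digraph_def pair_loopfree_digraph_axioms_def pair_pseudo_graph_def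
        pair_sym_digraph_def pair_sym_digraph_axioms_def)
qed

text \<open>
  Real eigenvalues in increasing order, repeated according to algebraic multiplicity. For a
  symmetric matrix of order $n$ the list has length $n$.
\<close>

definition eigenvalue_list :: "real mat \<Rightarrow> real list" where
  "eigenvalue_list M = sorted_list_of_multiset (proots (char_poly M))"

text \<open>
  Rational functions over the reals are elements of the field \<^typ>\<open>real poly fract\<close>. Since
  \<^term>\<open>char_poly_matrix M\<close> is $xI - M$, its image in that field is the matrix to invert. It is
  invertible because its determinant \<^term>\<open>char_poly M\<close> is monic.
\<close>

definition coronal :: "real mat \<Rightarrow> real poly fract" where
  "coronal M =
     (let one = vec (dim_row M) (\<lambda>_. 1)
      in one \<bullet> (the (mat_inverse (map_mat to_fract (char_poly_matrix M))) *\<^sub>v one))"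

text \<open>
  Substitution of a polynomial $q$ for the variable of a rational function. It is used only for
  \<open>q = [:- c, 1:]\<close>, that is $x - c$. For constant $q$ the denominator may vanish.
\<close>

definition fract_pcompose :: "real poly fract \<Rightarrow> real poly \<Rightarrow> real poly fract" where
  "fract_pcompose f q =
     (case quot_of_fract f of (a, b) \<Rightarrow> to_fract (a \<circ>\<^sub>p q) / to_fract (b \<circ>\<^sub>p q))"

lemma fract_pcompose_Fract:
  assumes "b \<noteq> 0" and "degree q > 0"
  shows "fract_pcompose (Fract a b) q = Fract (a \<circ>\<^sub>p q) (b \<circ>\<^sub>p q)"
proof -
  obtain a' b' where ab': "quot_of_fract (Fract a b) = (a', b')"
    by fastforce
  have b': "b' \<noteq> 0"
    using snd_quot_of_fract_nonzero[of "Fract a b"] ab' by simp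
  have "Fract a' b' = Fract a b"
    using Fract_quot_of_fract[of "Fract a b"] ab' by simp
  then have "a' * b = a * b'"
    using assms(1) b' by (simp add: eq_fract)
  then have "(a' \<circ>\<^sub>p q) * (b \<circ>\<^sub>p q) = (a \<circ>\<^sub>p q) * (b' \<circ>\<^sub>p q)"
    by (metis pcompose_mult)
  moreover have "b \<circ>\<^sub>p q \<noteq> 0" "b' \<circ>\<^sub>p q \<noteq> 0"
    using assms b' by (simp_all add: pcompose_eq_0_iff)
  ultimately show ?thesis
    by (simp add: fract_pcompose_def ab' to_fract_def eq_fract)
qed

end

theory Submission
  imports Defs "Jordan_Normal_Form.Schur_Decomposition"
begin

text \<open>
  List the vertices of the corona as those of \<open>G1\<close> followed by those of the copies of \<open>G2\<close>.
  Then \<open>xI - Q\<close> is a block matrix whose lower right block is \<open>I \<otimes> E\<close> with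
  \<open>E = (x - r1) I - Q(G2)\<close>, and whose off-diagonal blocks are \<open>-A \<otimes> 1\<^sup>T\<close> and \<open>-A \<otimes> 1\<close>,
  where \<open>A = Q(G1) - r1 I\<close> by regularity. If \<open>E y = 1\<close>, then \<open>-A \<otimes> y\<close> solves
  \<open>(I \<otimes> E) X = -A \<otimes> 1\<close>, so that the Schur complement of the lower right block is
  \<open>(x - n2 r1) I - Q(G1) - \<Gamma> A\<^sup>2\<close> with \<open>\<Gamma>\<close> the sum of the entries of \<open>y\<close>. It is a quadratic
  polynomial in the real symmetric matrix \<open>Q(G1)\<close>, and triangularising \<open>Q(G1)\<close> gives its
  determinant.
\<close>

subsection \<open>Matrices indexed by lists\<close>

text \<open>Indexing by list elements makes concatenation of lists a block decomposition and
  \<open>List.product\<close> a Kronecker structure, so entries can be computed on vertices instead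
  of positions.\<close>

definition lmat :: "'i list \<Rightarrow> 'j list \<Rightarrow> ('i \<Rightarrow> 'j \<Rightarrow> 'a) \<Rightarrow> 'a mat" where
  "lmat xs ys f = mat (length xs) (length ys) (\<lambda>(i, j). f (xs ! i) (ys ! j))"

lemma lmat_carrier [simp]: "lmat xs ys f \<in> carrier_mat (length xs) (length ys)"
  by (simp add: lmat_def)

lemma dim_lmat [simp]: "dim_row (lmat xs ys f) = length xs" "dim_col (lmat xs ys f) = length ys"
  by (simp_all add: lmat_def)

lemma lmat_cong:
  assumes "\<And>x y. x \<in> set xs \<Longrightarrow> y \<in> set ys \<Longrightarrow> f x y = g x y"
  shows "lmat xs ys f = lmat xs ys g"
  unfolding lmat_def by (rule eq_matI) (auto simp: assms)

lemma lmat_map: "lmat (map g xs) (map h ys) f = lmat xs ys (\<lambda>x y. f (g x) (h y))"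
  unfolding lmat_def by (rule eq_matI) auto

lemma lmat_append:
  "lmat (xs @ xs') (ys @ ys') f =
    four_block_mat (lmat xs ys f) (lmat xs ys' f) (lmat xs' ys f) (lmat xs' ys' f)"
  unfolding lmat_def by (rule eq_matI) (auto simp: nth_append)

lemma lmat_minus:
  fixes f g :: "_ \<Rightarrow> _ \<Rightarrow> 'a :: ring"
  shows "lmat xs ys f - lmat xs ys g = lmat xs ys (\<lambda>x y. f x y - g x y)"
  unfolding lmat_def by (rule eq_matI) auto

text \<open>Since \<open>ys\<close> is distinct, its positions biject with its elements, and the
  inner sum may run over a set.\<close>

lemma lmat_mult:
  fixes f :: "_ \<Rightarrow> _ \<Rightarrow> 'a :: semiring_0"
  assumes "distinct ys"
  shows "lmat xs ys f * lmat ys zs g = lmat xs zs (\<lambda>x z. \<Sum>y\<in>set ys. f x y * g y z)"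
proof (rule eq_matI)
  fix i j
  assume "i < dim_row (lmat xs zs (\<lambda>x z. \<Sum>y\<in>set ys. f x y * g y z))"
    and "j < dim_col (lmat xs zs (\<lambda>x z. \<Sum>y\<in>set ys. f x y * g y z))"
  moreover have "(\<Sum>k<length ys. f x (ys ! k) * g (ys ! k) z) = (\<Sum>y\<in>set ys. f x y * g y z)" for x z
    by (rule sum.reindex_bij_betw[OF bij_betw_nth[OF assms refl refl]])
  ultimately show "(lmat xs ys f * lmat ys zs g) $$ (i, j) =
      lmat xs zs (\<lambda>x z. \<Sum>y\<in>set ys. f x y * g y z) $$ (i, j)"
    by (simp add: lmat_def scalar_prod_def atLeast0LessThan)
qed auto

lemma char_poly_matrix_lmat:
  assumes "distinct vs"
  shows "char_poly_matrix (lmat vs vs f) =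
    lmat vs vs (\<lambda>u v. (if u = v then [:0, 1:] else 0) - [:f u v:])"
  using assms by (intro eq_matI) (auto simp: char_poly_matrix_def lmat_def nth_eq_iff_index_eq)

text \<open>Rows and columns undergo the same permutation, whose sign enters twice and cancels. This
  lets any enumeration of the corona be replaced by one adapted to its blocks.\<close>

lemma det_lmat_mset_cong:
  fixes f :: "'i \<Rightarrow> 'i \<Rightarrow> 'a :: comm_ring_1"
  assumes "mset xs = mset ys"
  shows "det (lmat xs xs f) = det (lmat ys ys f)"
proof -
  obtain p where p: "p permutes {..<length ys}" and xs: "permute_list p ys = xs"
    using mset_eq_permutation[OF assms] by blast
  have len: "length xs = length ys"
    using assms by (rule mset_eq_length)
  have p0: "p permutes {0..<length ys}"
    using p by (simp add: atLeast0LessThan)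
  have nth: "xs ! i = ys ! p i" if "i < length ys" for i
    using that p xs by (metis permute_list_nth)
  have pi: "p i < length ys" if "i < length ys" for i
    using that permutes_in_image[OF p] by auto
  let ?n = "length ys"
  \<comment> \<open>The intermediate matrix has its rows in the order of \<open>xs\<close> and its
    columns still in that of \<open>ys\<close>; the columns follow by transposition.\<close>
  let ?R = "lmat xs ys f"
  have "?R = mat ?n ?n (\<lambda>(i, j). lmat ys ys f $$ (p i, j))"
    by (rule eq_matI) (auto simp: lmat_def len nth pi)
  then have R: "det ?R = signof p * det (lmat ys ys f)"
    using det_permute_rows[OF lmat_carrier p0] by metis
  have "transpose_mat (lmat xs xs f) = mat ?n ?n (\<lambda>(i, j). transpose_mat ?R $$ (p i, j))"
    by (rule eq_matI) (auto simp: lmat_def len nth pi)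
  then have "det (transpose_mat (lmat xs xs f)) = signof p * det (transpose_mat ?R)"
    using det_permute_rows[of "transpose_mat ?R" ?n p] p0 len by (metis lmat_carrier transpose_carrier_mat)
  then have "det (lmat xs xs f) = signof p * det ?R"
    using det_transpose[of "lmat xs xs f"] det_transpose[of ?R ?n] len
    by (metis lmat_carrier)
  then show ?thesis
    by (simp add: R sign_def)
qed

text \<open>Writing the lower left block as \<open>D * X\<close> puts a solution \<open>X\<close> of
  a linear system in the place where the Schur complement would have the inverse of
  \<open>D\<close>.\<close>

lemma det_block_schur:
  fixes A B D X :: "'a :: idom mat"
  assumes A: "A \<in> carrier_mat n n" and B: "B \<in> carrier_mat n m"
    and D: "D \<in> carrier_mat m m" and X: "X \<in> carrier_mat m n"
  shows "det (four_block_mat A B (D * X) D) = det D * det (A - B * X)"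
proof -
  let ?M = "four_block_mat A B (D * X) D"
  \<comment> \<open>Right multiplication by this unipotent matrix subtracts the second block column
    times \<open>X\<close> from the first, which clears \<open>D * X\<close>.\<close>
  let ?N = "four_block_mat (1\<^sub>m n) (0\<^sub>m n m) (- X) (1\<^sub>m m)"
  have DX: "D * X \<in> carrier_mat m n" using D X by simp
  have "?M * ?N = four_block_mat (A * 1\<^sub>m n + B * (- X)) (A * 0\<^sub>m n m + B * 1\<^sub>m m)
      (D * X * 1\<^sub>m n + D * (- X)) (D * X * 0\<^sub>m n m + D * 1\<^sub>m m)"
    by (rule mult_four_block_mat) (use A B D X in auto)
  also have "A * 1\<^sub>m n + B * (- X) = A - B * X"
    using A B X by (intro eq_matI) auto
  also have "A * 0\<^sub>m n m + B * 1\<^sub>m m = B"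
    using A B by simp
  also have "D * X * 1\<^sub>m n + D * (- X) = 0\<^sub>m m n"
    using D X by (intro eq_matI) (auto simp: uminus_mult_right_mat)
  also have "D * X * 0\<^sub>m n m + D * 1\<^sub>m m = D"
    by (simp add: right_mult_zero_mat[OF DX] D right_mult_one_mat[OF D] left_add_zero_mat[OF D])
  finally have MN: "?M * ?N = four_block_mat (A - B * X) B (0\<^sub>m m n) D" .
  have "det ?M * det ?N = det (?M * ?N)"
    by (rule det_mult[symmetric]) (use A B D X in auto)
  also have "\<dots> = det (A - B * X) * det D"
    unfolding MN by (rule det_four_block_mat_lower_left_zero) (use A B D X in auto)
  also have "det ?N = 1"
    by (subst det_four_block_mat_upper_right_zero) (use X in auto)
  finally show ?thesis by (simp add: mult.commute)
qed

text \<open>The matrix is block diagonal with one copy of \<open>E\<close> for each element of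
  \<open>xs\<close>; the induction splits off the first copy.\<close>

lemma det_lmat_product:
  fixes E :: "'j \<Rightarrow> 'j \<Rightarrow> 'a :: idom"
  assumes "distinct xs"
  shows "det (lmat (List.product xs zs) (List.product xs zs)
      (\<lambda>(k, b) (l, c). if k = l then E b c else 0)) = det (lmat zs zs E) ^ length xs"
  using assms
proof (induction xs)
  case Nil
  \<comment> \<open>The determinant of the empty matrix is 1.\<close>
  then show ?case by (simp add: det_def lmat_def)
next
  case (Cons x xs)
  let ?F = "\<lambda>(k, b) (l, c). if k = l then E b c else 0"
  let ?L = "List.product xs zs" and ?Lx = "map (Pair x) zs"
  \<comment> \<open>As \<open>x\<close> does not occur in \<open>xs\<close>, the first components
    differ throughout this block.\<close>
  have "lmat ?L ?Lx ?F = lmat ?L ?Lx (\<lambda>_ _. 0)"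
    by (rule lmat_cong) (use Cons.prems in auto)
  also have "\<dots> = 0\<^sub>m (length ?L) (length ?Lx)"
    by (rule eq_matI) (simp_all add: lmat_def)
  finally have Z: "lmat ?L ?Lx ?F = 0\<^sub>m (length ?L) (length ?Lx)" .
  have "det (lmat (?Lx @ ?L) (?Lx @ ?L) ?F) = det (lmat ?Lx ?Lx ?F) * det (lmat ?L ?L ?F)"
    unfolding lmat_append
    by (rule det_four_block_mat_lower_left_zero[OF _ _ Z]) (rule lmat_carrier)+
  also have "lmat ?Lx ?Lx ?F = lmat zs zs E"
    by (simp add: lmat_map)
  finally show ?case using Cons by simp
qed

text \<open>This is the Schur complement step for abstract entries. The system for the large block
  reduces to \<open>E y = 1\<close>, because all rows of one copy meet the vertices of the base
  graph in the same way.\<close>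

lemma det_corona_matrix:
  fixes S A :: "'i \<Rightarrow> 'i \<Rightarrow> 'a :: idom" and E :: "'j \<Rightarrow> 'j \<Rightarrow> 'a" and y :: "'j \<Rightarrow> 'a"
    and K :: "'i + 'i \<times> 'j \<Rightarrow> 'i + 'i \<times> 'j \<Rightarrow> 'a"
  assumes xs: "distinct xs" and zs: "distinct zs"
    and y: "\<And>b. b \<in> set zs \<Longrightarrow> (\<Sum>c\<in>set zs. E b c * y c) = 1"
    and S: "\<And>i j. i \<in> set xs \<Longrightarrow> j \<in> set xs \<Longrightarrow> K (Inl i) (Inl j) = S i j"
    and B: "\<And>i k b. i \<in> set xs \<Longrightarrow> k \<in> set xs \<Longrightarrow> b \<in> set zs \<Longrightarrow> K (Inl i) (Inr (k, b)) = - A i k"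
    and C: "\<And>i k b. i \<in> set xs \<Longrightarrow> k \<in> set xs \<Longrightarrow> b \<in> set zs \<Longrightarrow> K (Inr (k, b)) (Inl i) = - A k i"
    and D: "\<And>k l b c. k \<in> set xs \<Longrightarrow> l \<in> set xs \<Longrightarrow> b \<in> set zs \<Longrightarrow> c \<in> set zs \<Longrightarrow>
      K (Inr (k, b)) (Inr (l, c)) = (if k = l then E b c else 0)"
  defines "L \<equiv> map Inl xs @ map Inr (List.product xs zs)"
  shows "det (lmat L L K) = det (lmat zs zs E) ^ length xs *
    det (lmat xs xs (\<lambda>i j. S i j - (\<Sum>b\<in>set zs. y b) * (\<Sum>k\<in>set xs. A i k * A k j)))"
proof -
  let ?P = "List.product xs zs"
  let ?B = "lmat xs ?P (\<lambda>i (k, b). - A i k)"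
  let ?D = "lmat ?P ?P (\<lambda>(k, b) (l, c). if k = l then E b c else 0)"
  let ?X = "lmat ?P xs (\<lambda>(l, c) j. - (A l j * y c))"
  have P: "distinct ?P"
    using xs zs by (rule distinct_product)
  have DX: "?D * ?X = lmat ?P xs (\<lambda>(k, b) j. - A k j)"
    unfolding lmat_mult[OF P]
  proof (rule lmat_cong, goal_cases)
    case (1 p j)
    then obtain k b where p: "p = (k, b)" and k: "k \<in> set xs" and b: "b \<in> set zs" by auto
    have "(\<Sum>q\<in>set ?P. (case q of (l, c) \<Rightarrow> if k = l then E b c else 0) *
        (case q of (l, c) \<Rightarrow> \<lambda>j. - (A l j * y c)) j)
      = (\<Sum>l\<in>set xs. \<Sum>c\<in>set zs. if k = l then - A l j * (E b c * y c) else 0)"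
      unfolding sum.cartesian_product set_product
      by (rule sum.cong) auto
    \<comment> \<open>Only the copy \<open>l = k\<close> contributes, and there the sum over
      \<open>c\<close> is row \<open>b\<close> of \<open>E y\<close>.\<close>
    also have "\<dots> = (\<Sum>l\<in>set xs. if k = l then \<Sum>c\<in>set zs. - A l j * (E b c * y c) else 0)"
      by (rule sum.cong) auto
    also have "\<dots> = - A k j * (\<Sum>c\<in>set zs. E b c * y c)"
      using k by (simp add: sum_distrib_left)
    finally show ?case
      using y[OF b] by (simp add: p)
  qed
  have BX: "?B * ?X = lmat xs xs (\<lambda>i j. (\<Sum>b\<in>set zs. y b) * (\<Sum>k\<in>set xs. A i k * A k j))"
    unfolding lmat_mult[OF P]
  proof (rule lmat_cong)
    fix i j
    \<comment> \<open>The two signs cancel, and the sum over pairs factors since \<open>y\<close>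
      depends on \<open>b\<close> alone and the entries of \<open>A\<close> do not involve
      \<open>b\<close>.\<close>
    have "(\<Sum>p\<in>set ?P. (case p of (k, b) \<Rightarrow> - A i k) * (case p of (l, c) \<Rightarrow> \<lambda>j. - (A l j * y c)) j)
      = (\<Sum>k\<in>set xs. \<Sum>b\<in>set zs. y b * (A i k * A k j))"
      by (simp add: sum.cartesian_product, rule sum.cong) (auto split: prod.splits)
    also have "\<dots> = (\<Sum>b\<in>set zs. y b) * (\<Sum>k\<in>set xs. A i k * A k j)"
      by (subst sum.swap) (simp add: sum_product)
    finally show "(\<Sum>p\<in>set ?P. (case p of (k, b) \<Rightarrow> - A i k) * (case p of (l, c) \<Rightarrow> \<lambda>j. - (A l j * y c)) j)
      = (\<Sum>b\<in>set zs. y b) * (\<Sum>k\<in>set xs. A i k * A k j)" .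
  qed
  have blocks: "lmat xs xs (\<lambda>i j. K (Inl i) (Inl j)) = lmat xs xs S"
    "lmat xs ?P (\<lambda>i p. K (Inl i) (Inr p)) = ?B"
    "lmat ?P xs (\<lambda>p j. K (Inr p) (Inl j)) = lmat ?P xs (\<lambda>(k, b) j. - A k j)"
    "lmat ?P ?P (\<lambda>p q. K (Inr p) (Inr q)) = ?D"
    by (rule lmat_cong; clarsimp simp: S B C D)+
  have "lmat L L K = four_block_mat (lmat xs xs S) ?B (?D * ?X) ?D"
    unfolding L_def lmat_append lmat_map DX blocks ..
  then have "det (lmat L L K) = det (four_block_mat (lmat xs xs S) ?B (?D * ?X) ?D)"
    by (rule arg_cong)
  also have "\<dots> = det ?D * det (lmat xs xs S - ?B * ?X)"
    by (rule det_block_schur) (rule lmat_carrier)+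
  finally show ?thesis
    unfolding BX lmat_minus det_lmat_product[OF xs] .
qed

subsection \<open>Spectra of real symmetric matrices\<close>

lemma conjugate_mult_mat_vec_of_real:
  assumes "A \<in> carrier_mat n n" and "v \<in> carrier_vec n"
  shows "conjugate (map_mat complex_of_real A *\<^sub>v v) = map_mat complex_of_real A *\<^sub>v conjugate v"
  using assms by (intro eq_vecI) (auto simp: scalar_prod_def)

text \<open>For an eigenvector \<open>v\<close>, symmetry moves the matrix across the product of
  \<open>v\<close> with its conjugate. This product is nonzero and gets multiplied by
  \<open>a\<close> on one side and by \<open>cnj a\<close> on the other.\<close>

lemma eigenvalue_symmetric_real:
  assumes A: "A \<in> carrier_mat n n" and sym: "transpose_mat A = A"
    and ev: "eigenvalue (map_mat complex_of_real A) a"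
  shows "a \<in> \<real>"
proof -
  let ?A = "map_mat complex_of_real A"
  have cA: "?A \<in> carrier_mat n n" using A by simp
  have "transpose_mat ?A = map_mat complex_of_real (transpose_mat A)"
    by (rule eq_matI) auto
  then have sA: "transpose_mat ?A = ?A" using sym by simp
  obtain v where v: "v \<in> carrier_vec n" "v \<noteq> 0\<^sub>v n" and Av: "?A *\<^sub>v v = a \<cdot>\<^sub>v v"
    using ev A by (auto simp: eigenvalue_def eigenvector_def)
  have cv: "conjugate v \<in> carrier_vec n" using v by simp
  have "(?A *\<^sub>v v) \<bullet> conjugate v = v \<bullet> (?A *\<^sub>v conjugate v)"
    using transpose_vec_mult_scalar[OF cA cv v(1)] by (simp only: sA)
  \<comment> \<open>The entries are real, so conjugation commutes with the matrix.\<close>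
  also have "?A *\<^sub>v conjugate v = conjugate (a \<cdot>\<^sub>v v)"
    using conjugate_mult_mat_vec_of_real[OF A v(1)] Av by simp
  finally have "a * (v \<bullet> conjugate v) = cnj a * (v \<bullet> conjugate v)"
    using v cv by (simp add: Av conjugate_smult_vec)
  moreover have "v \<bullet> conjugate v \<noteq> 0"
    using v by simp
  ultimately have "cnj a = a" by simp
  then show ?thesis by (simp add: Reals_cnj_iff)
qed

lemma prod_list_linear_of_real:
  assumes "\<forall>a\<in>set as. a \<in> \<real>"
  shows "(\<Prod>a\<leftarrow>as. [:- a, 1:]) = map_poly complex_of_real (\<Prod>a\<leftarrow>map Re as. [:- a, 1:])"
  using assms
proof (induction as)
  interpret map_poly_comm_ring_hom complex_of_real ..
  case (Cons a as)
  then have "[:- a, 1:] = map_poly complex_of_real [:- Re a, 1:]"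
    by (auto simp: map_poly_pCons elim: Reals_cases)
  with Cons show ?case by (simp add: hom_mult del: mult_pCons_left)
qed auto

text \<open>The characteristic polynomial splits over the complex numbers, and all its roots are
  real eigenvalues, so the factorisation descends to the reals.\<close>

lemma char_poly_symmetric_splits:
  fixes A :: "real mat"
  assumes A: "A \<in> carrier_mat n n" and sym: "transpose_mat A = A"
  obtains es where "char_poly A = (\<Prod>a\<leftarrow>es. [:- a, 1:])"
proof -
  let ?A = "map_mat complex_of_real A"
  have cA: "?A \<in> carrier_mat n n" using A by simp
  obtain as where as: "char_poly ?A = (\<Prod>a\<leftarrow>as. [:- a, 1:])"
    using char_poly_factorized[OF cA] by blast
  have "a \<in> \<real>" if "a \<in> set as" for a
  proof -
    have "poly (char_poly ?A) a = 0"
      using that by (simp add: as poly_prod_list prod_list_zero_iff)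
    then show ?thesis
      using eigenvalue_symmetric_real[OF A sym] eigenvalue_root_char_poly[OF cA] by blast
  qed
  then have "map_poly complex_of_real (char_poly A) =
      map_poly complex_of_real (\<Prod>a\<leftarrow>map Re as. [:- a, 1:])"
    using as prod_list_linear_of_real[of as] of_real_hom.char_poly_hom[OF A] by metis
  \<comment> \<open>Coefficients can be compared because \<open>complex_of_real\<close> is
    injective.\<close>
  then have "char_poly A = (\<Prod>a\<leftarrow>map Re as. [:- a, 1:])"
    by (simp add: poly_eq_iff coeff_map_poly)
  then show ?thesis by (rule that)
qed

text \<open>The roots of a product of linear factors, with multiplicity, are the listed ones, so
  sorting them leaves the product unchanged. The length is the degree \<open>n\<close>.\<close>

lemma char_poly_eigenvalue_list:
  assumes A: "A \<in> carrier_mat n n" and sym: "transpose_mat A = A"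
  shows "char_poly A = (\<Prod>a\<leftarrow>eigenvalue_list A. [:- a, 1:])" and "length (eigenvalue_list A) = n"
proof -
  obtain es where es: "char_poly A = (\<Prod>a\<leftarrow>es. [:- a, 1:])"
    using char_poly_symmetric_splits[OF assms] by blast
  have "proots (char_poly A) = (\<Sum>a\<leftarrow>es. {#a#})"
    unfolding es by (subst proots_prod_list[of "map (\<lambda>a. [:- a, 1:]) es", simplified]) (auto simp: o_def)
  also have "\<dots> = mset es" by (induction es) auto
  finally have m: "mset (eigenvalue_list A) = mset es"
    by (simp add: eigenvalue_list_def)
  then have "mset (map (\<lambda>a. [:- a, 1:]) (eigenvalue_list A)) = mset (map (\<lambda>a. [:- a, 1:]) es)"
    by simp
  then show "char_poly A = (\<Prod>a\<leftarrow>eigenvalue_list A. [:- a, 1:])"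
    unfolding es by (metis prod_mset_prod_list)
  have "length es = degree (char_poly A)"
    unfolding es by (rule degree_linear_factors[of uminus, symmetric])
  then show "length (eigenvalue_list A) = n"
    using degree_monic_char_poly[OF A] mset_eq_length[OF m] by simp
qed

text \<open>A polynomial in a matrix respects similarity, and for triangular \<open>B\<close> it is
  triangular with the polynomial applied to each diagonal entry. The homomorphism carries the
  triangularisation into a ring containing the coefficients, later the rational functions.\<close>

lemma (in comm_ring_hom) det_quadratic:
  fixes c0 c1 c2 :: 'b
  assumes sim: "similar_mat_wit A B P Q" and A: "A \<in> carrier_mat n n" and ut: "upper_triangular B"
  shows "det (mat n n (\<lambda>(i, j). (if i = j then c0 else 0) + c1 * hom (A $$ (i, j)) +
      c2 * (\<Sum>k<n. hom (A $$ (i, k)) * hom (A $$ (k, j))))) =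
    (\<Prod>a\<leftarrow>diag_mat B. c0 + c1 * hom a + c2 * (hom a)\<^sup>2)"
proof -
  let ?q = "\<lambda>M. c0 \<cdot>\<^sub>m 1\<^sub>m n + c1 \<cdot>\<^sub>m M + c2 \<cdot>\<^sub>m (M * M)"
  define A' B' P' Q' where defs: "A' = map_mat hom A" "B' = map_mat hom B" "P' = map_mat hom P" "Q' = map_mat hom Q"
  note w = similar_mat_witD2[OF A sim]
  have c: "A' \<in> carrier_mat n n" "B' \<in> carrier_mat n n" "P' \<in> carrier_mat n n" "Q' \<in> carrier_mat n n"
    using w by (simp_all add: defs)
  have B0: "B' $$ (i, j) = 0" if "j < i" "i < n" for i j
    using that ut w by (simp add: defs upper_triangularD)
  have PQ: "P' * Q' = 1\<^sub>m n" and QP: "Q' * P' = 1\<^sub>m n"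
    using w unfolding defs by (simp_all flip: mat_hom_mult[of _ n n _ n] add: mat_hom_one)
  have A': "A' = P' * B' * Q'"
    using w unfolding defs by (simp flip: mat_hom_mult[of _ n n _ n])
  \<comment> \<open>The inner factor \<open>Q' * P'\<close> is the identity, so the square is
    conjugated by the same pair.\<close>
  have "A' * A' = P' * (B' * (Q' * P') * B') * Q'"
    using c by (simp add: A' assoc_mult_mat[of _ n n _ n _ n])
  then have AA: "A' * A' = P' * (B' * B') * Q'"
    using c by (simp add: QP)
  have "?q A' = P' * ?q B' * Q'"
  proof -
    have "P' * ?q B' * Q' = P' * (c0 \<cdot>\<^sub>m 1\<^sub>m n) * Q' + P' * (c1 \<cdot>\<^sub>m B') * Q' + P' * (c2 \<cdot>\<^sub>m (B' * B')) * Q'"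
      using c by (simp add: mult_add_distrib_mat[of _ n n _ n] add_mult_distrib_mat[of _ n n _ _ n])
    also have "\<dots> = c0 \<cdot>\<^sub>m (P' * Q') + c1 \<cdot>\<^sub>m (P' * B' * Q') + c2 \<cdot>\<^sub>m (P' * (B' * B') * Q')"
      using c by (simp add: mult_smult_distrib[of _ n n _ n] mult_smult_assoc_mat[of _ n n _ n])
    finally show ?thesis
      by (simp add: PQ AA flip: A')
  qed
  then have "similar_mat (?q A') (?q B')"
    using c PQ QP by (intro similar_matI[of _ _ P' Q' n]) auto
  then have "det (?q A') = det (?q B')"
    by (rule det_similar)
  also have "\<dots> = prod_list (diag_mat (?q B'))"
  proof (rule det_upper_triangular)
    show "?q B' \<in> carrier_mat n n" using c by simp
    show "upper_triangular (?q B')"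
    proof
      fix i j assume "j < i" "i < dim_row (?q B')"
      then have ij: "j < i" "i < n" using c by auto
      \<comment> \<open>Either \<open>k < i\<close> and the first factor lies below the diagonal, or
        \<open>j < i \<le> k\<close> and the second does.\<close>
      have "B' $$ (i, k) * B' $$ (k, j) = 0" if "k < n" for k
        using B0[of k i] B0[of j k] that ij by (cases "k < i") auto
      then show "?q B' $$ (i, j) = 0"
        using c ij B0[of j i] by (simp add: scalar_prod_def)
    qed
  qed
  also have "diag_mat (?q B') = map (\<lambda>a. c0 + c1 * hom a + c2 * (hom a)\<^sup>2) (diag_mat B)"
  proof -
    \<comment> \<open>On the diagonal of the square only \<open>k = i\<close> survives: for any
      other \<open>k\<close> one of the two factors lies below the diagonal.\<close>
    have "(\<Sum>k = 0..<n. B' $$ (i, k) * B' $$ (k, i)) = (\<Sum>k = 0..<n. if k = i then (B' $$ (i, i))\<^sup>2 else 0)"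
      if "i < n" for i
    proof (rule sum.cong)
      fix k assume "k \<in> {0..<n}"
      then show "B' $$ (i, k) * B' $$ (k, i) = (if k = i then (B' $$ (i, i))\<^sup>2 else 0)"
        using B0[of k i] B0[of i k] that by (cases k i rule: linorder_cases) (auto simp: power2_eq_square)
    qed simp
    then show ?thesis
      using c w by (auto simp: diag_mat_def scalar_prod_def defs(2))
  qed
  also have "?q A' = mat n n (\<lambda>(i, j). (if i = j then c0 else 0) + c1 * hom (A $$ (i, j)) +
      c2 * (\<Sum>k<n. hom (A $$ (i, k)) * hom (A $$ (k, j))))"
    using A by (intro eq_matI) (auto simp: defs scalar_prod_def atLeast0LessThan)
  finally show ?thesis .
qed

subsection \<open>Substitution and coronals\<close>

lemma fract_pcompose_to_fract: "fract_pcompose (to_fract p) q = to_fract (p \<circ>\<^sub>p q)"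
  by (simp add: fract_pcompose_def)

text \<open>Composition with a polynomial of positive degree keeps denominators nonzero, so
  numerators and denominators can be substituted separately. Linear systems over the rational
  functions can then be shifted as a whole.\<close>

lemma fract_pcompose_hom:
  assumes "degree q > 0"
  shows "comm_ring_hom (\<lambda>f. fract_pcompose f q)"
proof
  fix f g :: "real poly fract"
  obtain a b where f: "f = Fract a b" "b \<noteq> 0" by (cases f)
  obtain c d where g: "g = Fract c d" "d \<noteq> 0" by (cases g)
  have nz: "b \<circ>\<^sub>p q \<noteq> 0" "d \<circ>\<^sub>p q \<noteq> 0"
    using f g assms by (simp_all add: pcompose_eq_0_iff)
  show "fract_pcompose (f + g) q = fract_pcompose f q + fract_pcompose g q"
    using f g nz assms by (simp add: fract_pcompose_Fract pcompose_add pcompose_mult)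
  show "fract_pcompose (f * g) q = fract_pcompose f q * fract_pcompose g q"
    using f g nz assms by (simp add: fract_pcompose_Fract pcompose_mult)
next
  show "fract_pcompose 1 q = 1"
    using fract_pcompose_to_fract[of 1 q] by (simp add: pcompose_1)
  show "fract_pcompose 0 q = 0"
    using fract_pcompose_to_fract[of 0 q] by simp
qed

lemma to_fract_pcompose_hom: "comm_ring_hom (\<lambda>p :: real poly. to_fract (p \<circ>\<^sub>p q))"
  by unfold_locales (simp_all add: pcompose_add pcompose_mult pcompose_1)

lemma det_lmat_hom:
  assumes "comm_ring_hom h"
  shows "det (lmat xs xs (\<lambda>x y. h (f x y))) = h (det (lmat xs xs f))"
proof -
  have "lmat xs xs (\<lambda>x y. h (f x y)) = map_mat h (lmat xs xs f)"
    by (rule eq_matI) (auto simp: lmat_def)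
  then show ?thesis
    using comm_ring_hom.hom_det[OF assms] by metis
qed

text \<open>The vector \<open>y\<close> is the inverse of \<open>xI - M\<close> applied to the
  all-ones vector. Only the linear system and the sum of its solution are kept, which is the input
  that the Schur complement needs.\<close>

lemma coronal_lmat_solution:
  assumes vs: "distinct vs"
  obtains y where "coronal (lmat vs vs f) = (\<Sum>v\<in>set vs. y v)"
    and "\<And>u. u \<in> set vs \<Longrightarrow>
      (\<Sum>v\<in>set vs. to_fract ((if u = v then [:0, 1:] else 0) - [:f u v:]) * y v) = 1"
proof -
  let ?n = "length vs"
  let ?M = "lmat vs vs f"
  let ?C = "map_mat to_fract (char_poly_matrix ?M)"
  let ?one = "vec ?n (\<lambda>_. 1 :: real poly fract)"
  have C: "?C \<in> carrier_mat ?n ?n" by (simp add: char_poly_matrix_def)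
  interpret comm_ring_hom "to_fract :: real poly \<Rightarrow> _" by unfold_locales auto
  have "det ?C = to_fract (char_poly ?M)"
    by (simp add: char_poly_def)
  moreover have "char_poly ?M \<noteq> 0"
    using degree_monic_char_poly[OF lmat_carrier, of vs f] by auto
  ultimately have "det ?C \<noteq> 0" by simp
  \<comment> \<open>Over a field a nonzero determinant makes the matrix a unit. The argument
    \<open>b\<close> merely fills the extension slot of the matrix ring record.\<close>
  then obtain N where N: "mat_inverse ?C = Some N"
    using mat_inverse(1)[OF C, where b = "()"] det_non_zero_imp_unit[OF C, where b = "()"]
    by (cases "mat_inverse ?C") auto
  have CN: "?C * N = 1\<^sub>m ?n" and Nc: "N \<in> carrier_mat ?n ?n"
    using mat_inverse(2)[OF C N] by auto
  define w where "w = N *\<^sub>v ?one"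
  have w: "w \<in> carrier_vec ?n" using Nc by (simp add: w_def)
  have "?C *\<^sub>v w = ?one"
    using assoc_mult_mat_vec[OF C Nc, of ?one] by (simp add: w_def CN)
  have cor: "coronal ?M = (\<Sum>i<?n. w $ i)"
    using w by (simp add: coronal_def N flip: w_def) (simp add: scalar_prod_def atLeast0LessThan)
  \<comment> \<open>The solution is moved from positions to vertices; \<open>vs\<close> is distinct,
    so each vertex has one position.\<close>
  define y where "y v = w $ (the_inv_into {..<?n} ((!) vs) v)" for v
  have y: "y (vs ! i) = w $ i" if "i < ?n" for i
    using the_inv_into_f_f[OF inj_on_nth[OF vs]] that by (simp add: y_def)
  note sum_vs = sum.reindex_bij_betw[OF bij_betw_nth[OF vs refl refl], symmetric]
  show ?thesis
  proof
    show "coronal ?M = (\<Sum>v\<in>set vs. y v)"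
      by (simp add: cor sum_vs y)
    fix u assume "u \<in> set vs"
    then obtain i where i: "i < ?n" "u = vs ! i" by (auto simp: in_set_conv_nth)
    have "(\<Sum>v\<in>set vs. to_fract ((if u = v then [:0, 1:] else 0) - [:f u v:]) * y v) =
        (?C *\<^sub>v w) $ i"
      unfolding char_poly_matrix_lmat[OF vs] using i w
      by (simp add: sum_vs y scalar_prod_def lmat_def atLeast0LessThan)
    then show "(\<Sum>v\<in>set vs. to_fract ((if u = v then [:0, 1:] else 0) - [:f u v:]) * y v) = 1"
      using \<open>?C *\<^sub>v w = ?one\<close> i by simp
  qed
qed

subsection \<open>The signless Laplacian of the neighbourhood corona\<close>

definition signless_entry :: "'a pair_pre_digraph \<Rightarrow> 'a \<Rightarrow> 'a \<Rightarrow> real" where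
  "signless_entry G u v =
    (if u = v then real (out_degree (with_proj G) u) else 0) + (if (u, v) \<in> parcs G then 1 else 0)"

lemma signless_laplacian_lmat:
  "distinct vs \<Longrightarrow> signless_laplacian vs G = lmat vs vs (signless_entry G)"
  by (intro eq_matI)
    (auto simp: signless_laplacian_def degree_matrix_def adjacency_matrix_def signless_entry_def
      lmat_def nth_eq_iff_index_eq)

text \<open>Arcs leaving \<open>u\<close> correspond to their heads, so degrees become counts of
  neighbours.\<close>

lemma out_degree_with_proj: "out_degree (with_proj G) u = card {v. (u, v) \<in> parcs G}"
proof -
  have "out_arcs (with_proj G) u = Pair u ` {v. (u, v) \<in> parcs G}"
    by (auto simp: out_arcs_def)
  then show ?thesis
    by (simp add: out_degree_def card_image inj_on_def)
qed

lemma arc_sym: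
  assumes "pair_graph G"
  shows "(u, v) \<in> parcs G \<longleftrightarrow> (v, u) \<in> parcs G"
proof -
  interpret pair_graph G by (rule assms)
  show ?thesis using pair_sym_arcs by (auto simp: symmetric_def sym_def)
qed

lemma signless_entry_sym:
  assumes "pair_graph G"
  shows "signless_entry G u v = signless_entry G v u"
  using arc_sym[OF assms] by (auto simp: signless_entry_def)

section \<open>Degrees and matrix entries of the corona\<close>

context
  fixes G1 :: "'a pair_pre_digraph" and G2 :: "'b pair_pre_digraph"
  assumes G1: "pair_graph G1" and G2: "pair_graph G2"
begin

interpretation G1: pair_graph G1 by (rule G1)
interpretation G2: pair_graph G2 by (rule G2)

lemma finite_nbrs: "finite {v. (u, v) \<in> parcs G1}" "finite {b. (a, b) \<in> parcs G2}"
  by (rule finite_subset[OF _ G1.pair_finite_verts], use G1.arc_snd_in_verts in fastforce,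
      rule finite_subset[OF _ G2.pair_finite_verts], use G2.arc_snd_in_verts in fastforce)

text \<open>Each neighbour of \<open>u\<close> in \<open>G1\<close> contributes itself and all
  vertices of its own copy of \<open>G2\<close>.\<close>

lemma out_degree_corona_Inl:
  "out_degree (with_proj (neighbourhood_corona G1 G2)) (Inl u) =
    out_degree (with_proj G1) u + out_degree (with_proj G1) u * card (pverts G2)"
proof -
  let ?N = "{v. (u, v) \<in> parcs G1}"
  have "{p. (Inl u, p) \<in> parcs (neighbourhood_corona G1 G2)} = Inl ` ?N \<union> Inr ` (?N \<times> pverts G2)"
    by (auto simp: neighbourhood_corona_def)
  moreover have "card (Inl ` ?N \<union> Inr ` (?N \<times> pverts G2)) = card ?N + card ?N * card (pverts G2)"
    using finite_nbrs(1)[of u] G2.pair_finite_verts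
    by (subst card_Un_disjoint) (auto simp: card_image card_cartesian_product)
  ultimately show ?thesis
    by (simp add: out_degree_with_proj)
qed

text \<open>Besides its neighbours inside the copy, the vertex sees the neighbours of
  \<open>v\<close> in \<open>G1\<close>; symmetry of the arcs puts these in the form of
  out-neighbours.\<close>

lemma out_degree_corona_Inr:
  assumes "v \<in> pverts G1" "b \<in> pverts G2"
  shows "out_degree (with_proj (neighbourhood_corona G1 G2)) (Inr (v, b)) =
    out_degree (with_proj G2) b + out_degree (with_proj G1) v"
proof -
  let ?N = "{u. (v, u) \<in> parcs G1}" and ?M = "{c. (b, c) \<in> parcs G2}"
  have "{p. (Inr (v, b), p) \<in> parcs (neighbourhood_corona G1 G2)} = Inr ` Pair v ` ?M \<union> Inl ` ?N"
    using assms arc_sym[OF G1] by (auto simp: neighbourhood_corona_def)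
  moreover have "card (Inr ` Pair v ` ?M \<union> (Inl ` ?N :: ('a + 'a \<times> 'b) set)) = card ?M + card ?N"
    using finite_nbrs(1)[of v] finite_nbrs(2)[of b]
    by (subst card_Un_disjoint) (auto simp: card_image inj_on_def)
  ultimately show ?thesis
    by (simp add: out_degree_with_proj)
qed

text \<open>By regularity \<open>a\<close> is the adjacency matrix of \<open>G1\<close>. It is
  written through the signless Laplacian so that the Schur complement becomes a polynomial in that
  one matrix. Regularity also gives every vertex of a copy the same extra degree
  \<open>r\<close>.\<close>

lemma signless_entry_corona:
  assumes "regular r G1"
  defines "H \<equiv> neighbourhood_corona G1 G2"
  defines "a \<equiv> \<lambda>u v. signless_entry G1 u v - (if u = v then real r else 0)"
  shows "u \<in> pverts G1 \<Longrightarrow> signless_entry H (Inl u) (Inl v) =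
      signless_entry G1 u v + (if u = v then real (card (pverts G2)) * real r else 0)"
    and "u \<in> pverts G1 \<Longrightarrow> b \<in> pverts G2 \<Longrightarrow> signless_entry H (Inl u) (Inr (v, b)) = a u v"
    and "u \<in> pverts G1 \<Longrightarrow> b \<in> pverts G2 \<Longrightarrow> signless_entry H (Inr (v, b)) (Inl u) = a u v"
    and "u \<in> pverts G1 \<Longrightarrow> b \<in> pverts G2 \<Longrightarrow> signless_entry H (Inr (u, b)) (Inr (v, c)) =
      (if u = v then signless_entry G2 b c + (if b = c then real r else 0) else 0)"
proof -
  have deg: "out_degree (with_proj G1) w = r" if "w \<in> pverts G1" for w
    using assms(1) that by (simp add: regular_def)
  have arcs: "(Inl u, Inl v) \<in> parcs H \<longleftrightarrow> (u, v) \<in> parcs G1"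
    "b \<in> pverts G2 \<Longrightarrow> (Inl u, Inr (v, b)) \<in> parcs H \<longleftrightarrow> (u, v) \<in> parcs G1"
    "b \<in> pverts G2 \<Longrightarrow> (Inr (v, b), Inl u) \<in> parcs H \<longleftrightarrow> (u, v) \<in> parcs G1"
    "u \<in> pverts G1 \<Longrightarrow> (Inr (u, b), Inr (v, c)) \<in> parcs H \<longleftrightarrow> u = v \<and> (b, c) \<in> parcs G2"
    for u v b c
    by (auto simp: H_def neighbourhood_corona_def)
  show "u \<in> pverts G1 \<Longrightarrow> signless_entry H (Inl u) (Inl v) =
      signless_entry G1 u v + (if u = v then real (card (pverts G2)) * real r else 0)"
    by (simp add: signless_entry_def arcs) (auto simp: H_def out_degree_corona_Inl deg)
  show "u \<in> pverts G1 \<Longrightarrow> b \<in> pverts G2 \<Longrightarrow> signless_entry H (Inl u) (Inr (v, b)) = a u v"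
    and "u \<in> pverts G1 \<Longrightarrow> b \<in> pverts G2 \<Longrightarrow> signless_entry H (Inr (v, b)) (Inl u) = a u v"
    by (auto simp: signless_entry_def arcs a_def deg)
  show "u \<in> pverts G1 \<Longrightarrow> b \<in> pverts G2 \<Longrightarrow> signless_entry H (Inr (u, b)) (Inr (v, c)) =
      (if u = v then signless_entry G2 b c + (if b = c then real r else 0) else 0)"
    by (simp add: signless_entry_def arcs) (auto simp: H_def out_degree_corona_Inr deg)
qed

end

section \<open>Assembly of the characteristic polynomial from the blocks\<close>

theorem theorem2p5:
  fixes G1 :: "'a pair_pre_digraph" and G2 :: "'b pair_pre_digraph"
    and vs1 :: "'a list" and vs2 :: "'b list" and vs :: "('a + 'a \<times> 'b) list"
    and n1 n2 r1 :: nat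
  assumes "pair_graph G1" and "pair_graph G2"
    and "card (pverts G1) = n1" and "card (pverts G2) = n2"
    and "n1 \<ge> 2" and "n2 \<ge> 1" and "r1 \<ge> 1"
    and "regular r1 G1"
    and "vertex_enum vs1 G1" and "vertex_enum vs2 G2"
    and "vertex_enum vs (neighbourhood_corona G1 G2)"
  defines "Q1 \<equiv> signless_laplacian vs1 G1" and "Q2 \<equiv> signless_laplacian vs2 G2"
    and "Q \<equiv> signless_laplacian vs (neighbourhood_corona G1 G2)"
    and "shift \<equiv> [:- real r1, 1:]"
    and "\<nu> \<equiv> (\<lambda>i. eigenvalue_list (signless_laplacian vs1 G1) ! i)"
  shows "to_fract (char_poly Q) =
    to_fract (char_poly Q2 \<circ>\<^sub>p shift) ^ n1 *
    (\<Prod>i<n1. to_fract [:- (real n2 * real r1) - \<nu> i, 1:]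
       - fract_pcompose (coronal Q2) shift * to_fract [:(\<nu> i - real r1)\<^sup>2:])"
proof -
  let ?H = "neighbourhood_corona G1 G2"
  let ?X = "[:0, 1:] :: real poly"
  have vs1: "distinct vs1" "set vs1 = pverts G1" and vs2: "distinct vs2" "set vs2 = pverts G2"
    and vs: "distinct vs" "set vs = pverts ?H"
    using assms(9-11) by (simp_all add: vertex_enum_def)
  have n1: "length vs1 = n1" and n2: "card (pverts G2) = n2"
    using vs1 assms(3,4) distinct_card by force+
  have degree_shift: "degree shift > 0" by (simp add: shift_def)
  interpret shift: comm_ring_hom "\<lambda>f. fract_pcompose f shift"
    by (rule fract_pcompose_hom[OF degree_shift])
  interpret const: comm_ring_hom "\<lambda>c :: real. to_fract [:c:]"
    by unfold_locales (simp_all flip: to_fract_add to_fract_mult one_pCons)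
  define a where "a u v = signless_entry G1 u v - (if u = v then real r1 else 0)" for u v
  \<comment> \<open>These are the entries of \<open>xI - Q2\<close> before the shift; composing them
    with \<open>shift\<close> gives the diagonal block of the corona.\<close>
  define e where "e b c = (if b = c then ?X else 0) - [:signless_entry G2 b c:]" for b c
  define K where "K p q = to_fract ((if p = q then ?X else 0) - [:signless_entry ?H p q:])" for p q
  define S where "S u v = to_fract ((if u = v then [:- (real n2 * real r1), 1:] else 0)
    - [:signless_entry G1 u v:])" for u v
  define g where "g = fract_pcompose (coronal Q2) shift"
  note entry = signless_entry_corona[OF assms(1,2,8), unfolded n2, folded a_def]

  obtain y where y: "coronal Q2 = (\<Sum>b\<in>set vs2. y b)"
    and ey: "\<And>b. b \<in> set vs2 \<Longrightarrow> (\<Sum>c\<in>set vs2. to_fract (e b c) * y c) = 1"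
    unfolding Q2_def signless_laplacian_lmat[OF vs2(1)] e_def
    by (rule coronal_lmat_solution[OF vs2(1), of "signless_entry G2"]) blast
  \<comment> \<open>Substitution is a ring homomorphism, so the shifted \<open>y\<close> solves the
    shifted system, and its entries sum to the shifted coronal \<open>g\<close>.\<close>
  have ey': "(\<Sum>c\<in>set vs2. to_fract (e b c \<circ>\<^sub>p shift) * fract_pcompose (y c) shift) = 1"
    if "b \<in> set vs2" for b
    using arg_cong[OF ey[OF that], of "\<lambda>f. fract_pcompose f shift"]
    by (simp add: shift.hom_sum shift.hom_mult shift.hom_one fract_pcompose_to_fract)
  have g: "g = (\<Sum>b\<in>set vs2. fract_pcompose (y b) shift)"
    by (simp add: g_def y shift.hom_sum)

  let ?L = "map Inl vs1 @ map Inr (List.product vs1 vs2)"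
  have "distinct ?L" "set ?L = set vs"
    using vs1 vs2 vs by (auto simp: distinct_map distinct_product neighbourhood_corona_def)
  then have mset: "mset vs = mset ?L"
    using vs(1) set_eq_iff_mset_eq_distinct by blast
  have hom: "comm_ring_hom (to_fract :: real poly \<Rightarrow> _)" by unfold_locales auto
  have "to_fract (char_poly Q) = det (lmat vs vs K)"
    unfolding Q_def signless_laplacian_lmat[OF vs(1)] char_poly_def char_poly_matrix_lmat[OF vs(1)] K_def
    by (rule det_lmat_hom[OF hom, symmetric])
  also have "\<dots> = det (lmat ?L ?L K)"
    by (rule det_lmat_mset_cong[OF mset])
  also have "\<dots> = det (lmat vs2 vs2 (\<lambda>b c. to_fract (e b c \<circ>\<^sub>p shift))) ^ length vs1 *
      det (lmat vs1 vs1 (\<lambda>u v. S u v - g * (\<Sum>w\<in>set vs1. to_fract [:a u w:] * to_fract [:a w v:])))"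
    unfolding g
  proof (rule det_corona_matrix[OF vs1(1) vs2(1) ey'])
    fix u v b c assume uv: "u \<in> set vs1" "v \<in> set vs1"
    show "K (Inl u) (Inl v) = S u v"
      using uv by (auto simp: K_def S_def entry vs1 simp flip: to_fract_diff)
    assume b: "b \<in> set vs2"
    show "K (Inl u) (Inr (v, b)) = - to_fract [:a u v:]"
      using uv b by (simp add: K_def entry vs1 vs2 flip: to_fract_uminus)
    \<comment> \<open>The corona entry comes as \<open>a u v\<close>, whereas the block lemma
      expects the row index first.\<close>
    have "a u v = a v u"
      using signless_entry_sym[OF assms(1), of u v] by (auto simp: a_def)
    then show "K (Inr (v, b)) (Inl u) = - to_fract [:a v u:]"
      using uv b by (simp add: K_def entry vs1 vs2 flip: to_fract_uminus)
    assume c: "c \<in> set vs2"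
    \<comment> \<open>The extra degree \<open>r1\<close> on the diagonal is absorbed by replacing x
      with x - r1.\<close>
    show "K (Inr (u, b)) (Inr (v, c)) = (if u = v then to_fract (e b c \<circ>\<^sub>p shift) else 0)"
      using uv b c by (auto simp: K_def e_def shift_def entry vs1 vs2 pcompose_diff pcompose_pCons simp flip: to_fract_diff)
  qed
  also have "det (lmat vs2 vs2 (\<lambda>b c. to_fract (e b c \<circ>\<^sub>p shift))) = to_fract (char_poly Q2 \<circ>\<^sub>p shift)"
    unfolding Q2_def signless_laplacian_lmat[OF vs2(1)] char_poly_def char_poly_matrix_lmat[OF vs2(1)] e_def
    by (rule det_lmat_hom[OF to_fract_pcompose_hom])
  also have "det (lmat vs1 vs1 (\<lambda>u v. S u v - g * (\<Sum>w\<in>set vs1. to_fract [:a u w:] * to_fract [:a w v:]))) =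
      (\<Prod>i<n1. to_fract [:- (real n2 * real r1) - \<nu> i, 1:] - g * to_fract [:(\<nu> i - real r1)\<^sup>2:])"
  proof -
    let ?h = "\<lambda>c :: real. to_fract [:c:]"
    let ?r = "?h (real r1)"
    \<comment> \<open>These are the coefficients obtained by expanding x - n2 r1 - Q1 - g (Q1 -
      r1)^2 in powers of Q1; the quadratic one is \<open>- g\<close>.\<close>
    define c0 where "c0 = to_fract [:- (real n2 * real r1), 1:] - g * ?r\<^sup>2"
    define c1 where "c1 = 2 * g * ?r - 1"
    have Q1: "Q1 \<in> carrier_mat n1 n1"
      by (simp add: Q1_def signless_laplacian_lmat[OF vs1(1)] flip: n1)
    have Q1_nth: "Q1 $$ (i, j) = signless_entry G1 (vs1 ! i) (vs1 ! j)" if "i < n1" "j < n1" for i j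
      using that by (simp add: Q1_def signless_laplacian_lmat[OF vs1(1)] lmat_def n1)
    have sym: "transpose_mat Q1 = Q1"
      using Q1 by (intro eq_matI) (auto simp: Q1_nth signless_entry_sym[OF assms(1)])
    note eigs = char_poly_eigenvalue_list[OF Q1 sym]
    \<comment> \<open>The decomposition takes the order of the eigenvalues as input, so the diagonal
      of \<open>B\<close> is exactly this list.\<close>
    obtain B P P' where "schur_decomposition Q1 (eigenvalue_list Q1) = (B, P, P')"
      by (metis prod_cases3)
    then have B: "similar_mat_wit Q1 B P P'" "upper_triangular B" "diag_mat B = eigenvalue_list Q1"
      using schur_decomposition[OF Q1 eigs(1)] by blast+
    have entry_eq: "S (vs1 ! i) (vs1 ! j) -
        g * (\<Sum>w\<in>set vs1. ?h (a (vs1 ! i) w) * ?h (a w (vs1 ! j))) =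
      (if i = j then c0 else 0) + c1 * ?h (Q1 $$ (i, j)) +
        - g * (\<Sum>k<n1. ?h (Q1 $$ (i, k)) * ?h (Q1 $$ (k, j)))"
      if ij: "i < n1" "j < n1" for i j
    proof -
      let ?m = "\<lambda>i j. ?h (Q1 $$ (i, j))"
      have a_nth: "?h (a (vs1 ! i) (vs1 ! j)) = ?m i j - (if i = j then ?r else 0)"
        if "i < n1" "j < n1" for i j
        using that vs1(1) by (simp add: a_def Q1_nth nth_eq_iff_index_eq n1 flip: to_fract_diff)
      have "(\<Sum>w\<in>set vs1. ?h (a (vs1 ! i) w) * ?h (a w (vs1 ! j))) =
          (\<Sum>k<n1. ?h (a (vs1 ! i) (vs1 ! k)) * ?h (a (vs1 ! k) (vs1 ! j)))"
        using sum.reindex_bij_betw[OF bij_betw_nth[OF vs1(1) refl refl], symmetric] by (simp add: n1)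
      \<comment> \<open>Both factors are expanded, with each Kronecker delta written as a condition
        on \<open>k\<close> so that its sum collapses.\<close>
      also have "\<dots> = (\<Sum>k<n1. ?m i k * ?m k j - (if k = i then ?r * ?m k j else 0)
          - (if k = j then ?r * ?m i k else 0) + (if k = i then if i = j then ?r\<^sup>2 else 0 else 0))"
        using ij by (intro sum.cong) (auto simp: a_nth algebra_simps power2_eq_square)
      also have "\<dots> = (\<Sum>k<n1. ?m i k * ?m k j) - 2 * ?r * ?m i j + (if i = j then ?r\<^sup>2 else 0)"
        using ij by (simp add: sum.distrib sum_subtractf)
      finally have sum: "(\<Sum>w\<in>set vs1. ?h (a (vs1 ! i) w) * ?h (a w (vs1 ! j))) =
          (\<Sum>k<n1. ?m i k * ?m k j) - 2 * ?r * ?m i j + (if i = j then ?r\<^sup>2 else 0)" .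
      have "S (vs1 ! i) (vs1 ! j) =
          (if i = j then to_fract [:- (real n2 * real r1), 1:] else 0) - ?m i j"
        using ij vs1(1) by (simp add: S_def Q1_nth nth_eq_iff_index_eq n1 del: diff_pCons)
      then show ?thesis
        unfolding sum by (simp add: c0_def c1_def algebra_simps)
    qed
    have "lmat vs1 vs1 (\<lambda>u v. S u v - g * (\<Sum>w\<in>set vs1. ?h (a u w) * ?h (a w v))) =
      mat n1 n1 (\<lambda>(i, j). (if i = j then c0 else 0) + c1 * ?h (Q1 $$ (i, j)) +
        - g * (\<Sum>k<n1. ?h (Q1 $$ (i, k)) * ?h (Q1 $$ (k, j))))"
      unfolding lmat_def n1 by (rule cong_mat) (simp_all only: prod.case entry_eq)
    then have "det (lmat vs1 vs1 (\<lambda>u v. S u v - g * (\<Sum>w\<in>set vs1. ?h (a u w) * ?h (a w v)))) =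
      (\<Prod>x\<leftarrow>eigenvalue_list Q1. c0 + c1 * ?h x + - g * (?h x)\<^sup>2)"
      using const.det_quadratic[OF B(1) Q1 B(2), where ?c0.0 = c0 and ?c1.0 = c1 and ?c2.0 = "- g"]
      by (simp only: B(3))
    also have "\<dots> = (\<Prod>i<n1. c0 + c1 * ?h (\<nu> i) + - g * (?h (\<nu> i))\<^sup>2)"
      using eigs(2) by (simp add: prod.list_conv_set_nth atLeast0LessThan \<nu>_def Q1_def)
    \<comment> \<open>The expansion into \<open>c0\<close> and \<open>c1\<close> is undone at each
      eigenvalue.\<close>
    also have "\<dots> = (\<Prod>i<n1. to_fract [:- (real n2 * real r1) - \<nu> i, 1:] - g * to_fract [:(\<nu> i - real r1)\<^sup>2:])"
    proof (rule prod.cong)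
      fix i
      have lin: "to_fract [:- (real n2 * real r1) - \<nu> i, 1:] = to_fract [:- (real n2 * real r1), 1:] - ?h (\<nu> i)"
        by (simp flip: to_fract_diff)
      have sq: "?h ((\<nu> i - real r1)\<^sup>2) = (?h (\<nu> i) - ?r)\<^sup>2"
        by (simp only: const.hom_power const.hom_minus)
      show "c0 + c1 * ?h (\<nu> i) + - g * (?h (\<nu> i))\<^sup>2 =
          to_fract [:- (real n2 * real r1) - \<nu> i, 1:] - g * to_fract [:(\<nu> i - real r1)\<^sup>2:]"
        unfolding lin sq c0_def c1_def by (simp add: power2_eq_square algebra_simps)
    qed simp
    finally show ?thesis .
  qed
  finally show ?thesis
    by (simp only: n1 g_def)
qed

end
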